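(* The congruence $\mathrm R$ on the free monoid $\mathcal F_{\mathbf{Mon}}$ on the symbols $\eta_k,\varepsilon_k$ ($k\in\mathbb N$), for which $\mathcal F(\emptyset)=\mathcal F_{\mathbf{Mon}}/\mathrm R$ as monoids, is generated by the following set $\mathrm R_0$ of relations (for all $i,j\in\mathbb N$ satisfying the indicated conditions): $$\varepsilon_i\varepsilon_j=\varepsilon_{j-1}\varepsilon_i\ (j>i),\qquad \eta_j\eta_i=\eta_i\eta_{j-1}\ (j>i),$$ $$\varepsilon_i\eta_j=\begin{cases}\eta_{j-1}\varepsilon_i & (j>i+1)\\ \eta_j\varepsilon_{i-1} & (i>j)\\ \varepsilon_{i-1}\eta_i & (i=j>0)\\ \varepsilon_i\eta_i & (j=i+1)\\ 1 & (i=j=0).\end{cases}$$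
   Context: $\mathbb N=\{0,1,2,\dots\}$. Let $\mathbf{AdMonB}$ be the category (Birkhoff variety of algebras) whose objects are tuples $(M,f,\eta,\varepsilon)$ where $M$ is a monoid, $f\colon M\to M$ is a monoid endomorphism and $\eta,\varepsilon\in M$ satisfy $\varepsilon\eta=1$, $\varepsilon f(\eta)=1$, $\varepsilon f(\varepsilon)=\varepsilon^2$, $\varepsilon f^2(m)=f(m)\varepsilon$ for all $m\in M$, and $f(m)\eta=\eta m$ for all $m\in M$; morphisms are monoid homomorphisms commuting with the endomorphisms $f$ and preserving $\eta$ and $\varepsilon$. Let $\mathcal F(\emptyset)$ be the free $\mathbf{AdMonB}$-algebra on the empty set, i.e. the initial object of $\mathbf{AdMonB}$. In $\mathcal F(\emptyset)$ define $\eta_0:=\eta$, $\eta_{k+1}:=f(\eta_k)$, $\varepsilon_0:=\varepsilon$, $\varepsilon_{k+1}:=f(\varepsilon_k)$. As a monoid $\mathcal F(\emptyset)$ is generated by the elements $\eta_k,\varepsilon_k$ ($k\in\mathbb N$), so the monoid homomorphism $\mathcal F_{\mathbf{Mon}}\to\mathcal F(\emptyset)$ from the free monoid on symbols $\eta_k,\varepsilon_k$ ($k\in\mathbb N$), sending each symbol to the element of the same name, is surjective; $\mathrm R$ is its kernel congruence. *)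

theory Defs
  imports "HOL-Algebra.Group"
begin

record 'a admonb = "'a monoid" +
  endo :: "'a \<Rightarrow> 'a"
  eta :: 'a
  eps :: 'a

locale AdMonB = monoid A for A :: "('a, 'b) admonb_scheme" (structure) +
  assumes endo_hom: "endo A \<in> hom A A"
    and endo_one: "endo A \<one> = \<one>"
    and eta_closed: "eta A \<in> carrier A"
    and eps_closed: "eps A \<in> carrier A"
    and eps_eta: "eps A \<otimes> eta A = \<one>"
    and eps_endo_eta: "eps A \<otimes> endo A (eta A) = \<one>"
    and eps_endo_eps: "eps A \<otimes> endo A (eps A) = eps A \<otimes> eps A"
    and eps_endo_endo:
      "\<And>m. m \<in> carrier A \<Longrightarrow> eps A \<otimes> endo A (endo A m) = endo A m \<otimes> eps A"
    and endo_eta: "\<And>m. m \<in> carrier A \<Longrightarrow> endo A m \<otimes> eta A = eta A \<otimes> m"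

text \<open>Preservation of the unit is stated separately, since \<^const>\<open>hom\<close> only demands
  compatibility with multiplication.\<close>

definition AdMonB_hom ::
    "('a, 'c) admonb_scheme \<Rightarrow> ('b, 'd) admonb_scheme \<Rightarrow> ('a \<Rightarrow> 'b) set" where
  "AdMonB_hom A B = {h \<in> hom A B. h \<one>\<^bsub>A\<^esub> = \<one>\<^bsub>B\<^esub>
     \<and> (\<forall>x\<in>carrier A. h (endo A x) = endo B (h x))
     \<and> h (eta A) = eta B \<and> h (eps A) = eps B}"

definition eta_n :: "('a, 'b) admonb_scheme \<Rightarrow> nat \<Rightarrow> 'a" where
  "eta_n A k = (endo A ^^ k) (eta A)"

definition eps_n :: "('a, 'b) admonb_scheme \<Rightarrow> nat \<Rightarrow> 'a" where
  "eps_n A k = (endo A ^^ k) (eps A)"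

text \<open>Closed terms in the signature of AdMonB modulo the smallest congruence containing all
  instances of the defining identities. Initiality, with respect to algebras over arbitrary
  types, is proved below.\<close>

datatype adterm = TOne | TMul adterm adterm | TEndo adterm | TEta | TEps

inductive adeq :: "adterm \<Rightarrow> adterm \<Rightarrow> bool" where
  adeq_refl: "adeq s s"
| adeq_sym: "adeq s t \<Longrightarrow> adeq t s"
| adeq_trans: "adeq s t \<Longrightarrow> adeq t u \<Longrightarrow> adeq s u"
| adeq_mul: "adeq s s' \<Longrightarrow> adeq t t' \<Longrightarrow> adeq (TMul s t) (TMul s' t')"
| adeq_endo: "adeq s t \<Longrightarrow> adeq (TEndo s) (TEndo t)"
| adeq_assoc: "adeq (TMul (TMul s t) u) (TMul s (TMul t u))"
| adeq_l_one: "adeq (TMul TOne s) s"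
| adeq_r_one: "adeq (TMul s TOne) s"
| adeq_endo_mul: "adeq (TEndo (TMul s t)) (TMul (TEndo s) (TEndo t))"
| adeq_endo_one: "adeq (TEndo TOne) TOne"
| adeq_eps_eta: "adeq (TMul TEps TEta) TOne"
| adeq_eps_endo_eta: "adeq (TMul TEps (TEndo TEta)) TOne"
| adeq_eps_endo_eps: "adeq (TMul TEps (TEndo TEps)) (TMul TEps TEps)"
| adeq_eps_endo_endo: "adeq (TMul TEps (TEndo (TEndo s))) (TMul (TEndo s) TEps)"
| adeq_endo_eta: "adeq (TMul (TEndo s) TEta) (TMul TEta s)"

quotient_type adfree = adterm / adeq
  by (rule equivpI)
    (auto simp: reflp_def symp_def transp_def intro: adeq_refl adeq_sym adeq_trans)

lift_definition fone :: adfree is TOne .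
lift_definition fmul :: "adfree \<Rightarrow> adfree \<Rightarrow> adfree" is TMul by (rule adeq_mul)
lift_definition fendo :: "adfree \<Rightarrow> adfree" is TEndo by (rule adeq_endo)
lift_definition feta :: adfree is TEta .
lift_definition feps :: adfree is TEps .

definition F_empty :: "adfree admonb" where
  "F_empty = \<lparr>carrier = UNIV, mult = fmul, one = fone, endo = fendo, eta = feta, eps = feps\<rparr>"

lemma F_empty_simps [simp]:
  "carrier F_empty = UNIV" "mult F_empty = fmul" "one F_empty = fone"
  "endo F_empty = fendo" "eta F_empty = feta" "eps F_empty = feps"
  by (simp_all add: F_empty_def)

lemma AdMonB_F_empty: "AdMonB F_empty"
proof unfold_locales
qed (simp_all add: hom_def, (transfer, auto intro: adeq.intros)+)

primrec term_eval :: "('a, 'b) admonb_scheme \<Rightarrow> adterm \<Rightarrow> 'a" where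
  "term_eval A TOne = \<one>\<^bsub>A\<^esub>"
| "term_eval A (TMul s t) = term_eval A s \<otimes>\<^bsub>A\<^esub> term_eval A t"
| "term_eval A (TEndo s) = endo A (term_eval A s)"
| "term_eval A TEta = eta A"
| "term_eval A TEps = eps A"

lemma (in AdMonB) term_eval_closed: "term_eval A t \<in> carrier A"
  using endo_hom by (induction t) (auto simp: eta_closed eps_closed hom_def)

lemma (in AdMonB) term_eval_adeq: "adeq s t \<Longrightarrow> term_eval A s = term_eval A t"
proof (induction rule: adeq.induct)
  case (adeq_endo_mul s t)
  then show ?case using endo_hom term_eval_closed by (simp add: hom_def)
qed (simp_all add: term_eval_closed m_assoc endo_one eps_eta eps_endo_eta eps_endo_eps
    eps_endo_endo endo_eta)

lemma (in AdMonB) F_empty_initial_ex: "\<exists>h. h \<in> AdMonB_hom F_empty A"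
proof -
  have ev: "term_eval A (rep_adfree (abs_adfree t)) = term_eval A t" for t
    by (rule term_eval_adeq) (metis Quotient3_adfree Quotient3_rep_abs adeq_refl)
  define h where "h = (\<lambda>x. term_eval A (rep_adfree x))"
  have habs: "h (abs_adfree t) = term_eval A t" for t by (simp add: h_def ev)
  have ex: "\<exists>t. x = abs_adfree t" for x by (metis Quotient3_adfree Quotient3_abs_rep)
  have "h (fmul x y) = h x \<otimes> h y" for x y
    using ex[of x] ex[of y] by (auto simp: fmul.abs_eq habs)
  moreover have "h (fendo x) = endo A (h x)" for x
    using ex[of x] by (auto simp: fendo.abs_eq habs)
  moreover have "h fone = \<one>" "h feta = eta A" "h feps = eps A"
    by (simp_all add: fone_def feta_def feps_def habs)
  moreover have "h x \<in> carrier A" for x by (simp add: h_def term_eval_closed)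
  ultimately show ?thesis by (intro exI[of _ h]) (simp add: AdMonB_hom_def hom_def)
qed

lemma adfree_induct [case_names one mul endo eta eps]:
  assumes "P fone" "\<And>x y. P x \<Longrightarrow> P y \<Longrightarrow> P (fmul x y)" "\<And>x. P x \<Longrightarrow> P (fendo x)"
    "P feta" "P feps"
  shows "P x"
proof -
  have "P (abs_adfree t)" for t
    by (induction t)
      (use assms in \<open>simp_all add: fone_def feta_def feps_def flip: fmul.abs_eq fendo.abs_eq\<close>)
  then show ?thesis by (metis Quotient3_adfree Quotient3_abs_rep)
qed

lemma F_empty_initial:
  assumes "AdMonB A"
  shows "\<exists>!h. h \<in> AdMonB_hom F_empty A"
proof -
  have "h = h'" if "h \<in> AdMonB_hom F_empty A" "h' \<in> AdMonB_hom F_empty A" for h h'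
  proof
    fix x show "h x = h' x"
      by (induction x rule: adfree_induct) (use that in \<open>simp_all add: AdMonB_hom_def hom_def\<close>)
  qed
  then show ?thesis using AdMonB.F_empty_initial_ex[OF assms] by blast
qed

definition monoid_congruence :: "('a, 'b) monoid_scheme \<Rightarrow> ('a \<times> 'a) set \<Rightarrow> bool" where
  "monoid_congruence G r \<longleftrightarrow> equiv (carrier G) r
     \<and> (\<forall>a b c d. (a, b) \<in> r \<longrightarrow> (c, d) \<in> r \<longrightarrow> (a \<otimes>\<^bsub>G\<^esub> c, b \<otimes>\<^bsub>G\<^esub> d) \<in> r)"

definition generated_congruence ::
    "('a, 'b) monoid_scheme \<Rightarrow> ('a \<times> 'a) set \<Rightarrow> ('a \<times> 'a) set" where
  "generated_congruence G S = \<Inter>{r. monoid_congruence G r \<and> S \<subseteq> r}"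

definition kernel_congruence ::
    "('a, 'b) monoid_scheme \<Rightarrow> ('a \<Rightarrow> 'c) \<Rightarrow> ('a \<times> 'a) set" where
  "kernel_congruence G h = {(x, y). x \<in> carrier G \<and> y \<in> carrier G \<and> h x = h y}"

datatype symb = Eta nat | Eps nat

definition F_Mon :: "symb list monoid" where
  "F_Mon = \<lparr>carrier = UNIV, mult = (@), one = []\<rparr>"

primrec symb_val :: "symb \<Rightarrow> adfree" where
  "symb_val (Eta k) = eta_n F_empty k"
| "symb_val (Eps k) = eps_n F_empty k"

primrec canon :: "symb list \<Rightarrow> adfree" where
  "canon [] = \<one>\<^bsub>F_empty\<^esub>"
| "canon (x # w) = symb_val x \<otimes>\<^bsub>F_empty\<^esub> canon w"

lemma F_Mon_monoid: "monoid F_Mon"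
  by unfold_locales (auto simp: F_Mon_def)

lemma canon_append: "canon (u @ v) = fmul (canon u) (canon v)"
proof -
  interpret AdMonB F_empty by (rule AdMonB_F_empty)
  show ?thesis by (induction u) (use l_one m_assoc in simp_all)
qed

lemma canon_hom: "canon \<in> hom F_Mon F_empty" "canon \<one>\<^bsub>F_Mon\<^esub> = \<one>\<^bsub>F_empty\<^esub>"
  by (auto simp: hom_def F_Mon_def canon_append)

lemma canon_symb: "canon [x] = symb_val x"
proof -
  interpret AdMonB F_empty by (rule AdMonB_F_empty)
  show ?thesis using r_one by simp
qed

lemma canon_endo: "\<exists>w'. fendo (canon w) = canon w'"
proof (induction w)
  case Nil
  have "fendo fone = fone" by transfer (rule adeq_endo_one)
  then show ?case by (intro exI[of _ "[]"]) simp
next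
  case (Cons x w)
  then obtain w' where w': "fendo (canon w) = canon w'" by blast
  obtain x' where x': "fendo (symb_val x) = symb_val x'"
  proof (cases x)
    case (Eta k)
    then show ?thesis by (intro that[of "Eta (Suc k)"]) (simp add: eta_n_def)
  next
    case (Eps k)
    then show ?thesis by (intro that[of "Eps (Suc k)"]) (simp add: eps_n_def)
  qed
  have "fendo (fmul a b) = fmul (fendo a) (fendo b)" for a b
    by transfer (rule adeq_endo_mul)
  then show ?case using w' x' by (intro exI[of _ "x' # w'"]) simp
qed

lemma canon_surj: "canon ` carrier F_Mon = carrier F_empty"
proof -
  have "\<exists>w. x = canon w" for x
  proof (induction x rule: adfree_induct)
    case one
    show ?case by (intro exI[of _ "[]"]) simp
  next
    case (mul x y)
    then show ?case by (metis canon_append)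
  next
    case (endo x)
    then show ?case using canon_endo by blast
  next
    case eta
    show ?case by (intro exI[of _ "[Eta 0]"]) (simp add: canon_symb eta_n_def del: canon.simps)
  next
    case eps
    show ?case by (intro exI[of _ "[Eps 0]"]) (simp add: canon_symb eps_n_def del: canon.simps)
  qed
  then show ?thesis by (auto simp: F_Mon_def)
qed

definition R :: "(symb list \<times> symb list) set" where
  "R = kernel_congruence F_Mon canon"

definition R0 :: "(symb list \<times> symb list) set" where
  "R0 = {([Eps i, Eps j], [Eps (j - 1), Eps i]) | i j. j > i}
      \<union> {([Eta j, Eta i], [Eta i, Eta (j - 1)]) | i j. j > i}
      \<union> {([Eps i, Eta j], [Eta (j - 1), Eps i]) | i j. j > i + 1}
      \<union> {([Eps i, Eta j], [Eta j, Eps (i - 1)]) | i j. i > j}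
      \<union> {([Eps i, Eta j], [Eps (i - 1), Eta i]) | i j. i = j \<and> j > 0}
      \<union> {([Eps i, Eta j], [Eps i, Eta i]) | i j. j = i + 1}
      \<union> {([Eps i, Eta j], []) | i j. i = 0 \<and> j = 0}"

end

theory Submission imports Defs begin

text \<open>Write \<open>C\<close> for the congruence generated by \<open>R0\<close>. That \<open>C\<close> is contained in the kernel \<open>R\<close>
  amounts to deriving each relation of \<open>R0\<close> from the axioms of AdMonB. Up to a shift by a power of
  \<open>f\<close>, the exceptional relations come from the axioms without a variable
  (\<open>\<epsilon>\<^sub>0 \<epsilon>\<^sub>1 = \<epsilon>\<^sub>0 \<epsilon>\<^sub>0\<close>, \<open>\<epsilon>\<^sub>0 \<eta>\<^sub>0 = 1\<close> and \<open>\<epsilon>\<^sub>0 \<eta>\<^sub>1 = 1\<close>, the last two giving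
  \<open>\<epsilon>\<^sub>k \<eta>\<^sub>k = 1 = \<epsilon>\<^sub>k \<eta>\<^sub>k\<^sub>+\<^sub>1\<close>), and the remaining ones are the axioms for \<open>m\<close> with \<open>m\<close> a
  generator.

  For the converse, the words modulo \<open>C\<close> are themselves an AdMonB-algebra, whose endomorphism
  raises every index by one. It is well defined because a shifted relation of \<open>R0\<close> again belongs
  to \<open>C\<close>: it is a relation of the same shape, except that the shift of \<open>\<epsilon>\<^sub>0 \<eta>\<^sub>0 = 1\<close> needs the
  chain \<open>\<epsilon>\<^sub>1 \<eta>\<^sub>1 = \<epsilon>\<^sub>0 \<eta>\<^sub>1 = \<epsilon>\<^sub>0 \<eta>\<^sub>0 = 1\<close>. The two axioms that quantify over \<open>m\<close> need only be
  checked for generators, as a word can be traversed one letter at a time. The algebra is used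
  here without forming the quotient: a closed term denotes a word, provably equal terms denote
  \<open>C\<close>-equivalent words (\<open>adeq_word_of_term\<close>), and every word is denoted by a term
  whose class is its image in the initial algebra. Two words with the same image are then denoted
  by provably equal terms, and so are \<open>C\<close>-equivalent.\<close>

section \<open>Congruences on a monoid\<close>

lemma monoid_congruence_mult:
  "monoid_congruence G r \<Longrightarrow> (a, b) \<in> r \<Longrightarrow> (c, d) \<in> r
    \<Longrightarrow> (a \<otimes>\<^bsub>G\<^esub> c, b \<otimes>\<^bsub>G\<^esub> d) \<in> r"
  by (auto simp: monoid_congruence_def)

lemma generated_congruence_least:
  "monoid_congruence G r \<Longrightarrow> S \<subseteq> r \<Longrightarrow> generated_congruence G S \<subseteq> r"
  by (auto simp: generated_congruence_def)

lemma generated_congruence_base: "S \<subseteq> generated_congruence G S"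
  by (auto simp: generated_congruence_def)

text \<open>The condition on \<open>S\<close> makes the total relation a congruence above \<open>S\<close>, so that the
  intersection is not over an empty family.\<close>

lemma monoid_congruence_generated:
  assumes "monoid G" and S: "S \<subseteq> carrier G \<times> carrier G"
  shows "monoid_congruence G (generated_congruence G S)"
proof -
  interpret monoid G by fact
  have "monoid_congruence G (carrier G \<times> carrier G)"
    by (auto simp: monoid_congruence_def equiv_def refl_on_def sym_def trans_def)
  then have total: "generated_congruence G S \<subseteq> carrier G \<times> carrier G"
    using S by (rule generated_congruence_least)
  have mem: "(x, y) \<in> generated_congruence G S
      \<longleftrightarrow> (\<forall>r. monoid_congruence G r \<longrightarrow> S \<subseteq> r \<longrightarrow> (x, y) \<in> r)" for x y
    by (auto simp: generated_congruence_def)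
  have equiv: "equiv (carrier G) r" if "monoid_congruence G r" for r
    using that by (simp add: monoid_congruence_def)
  have "equiv (carrier G) (generated_congruence G S)"
  proof (rule equivI)
    show "generated_congruence G S \<subseteq> carrier G \<times> carrier G" by (rule total)
    show "refl_on (carrier G) (generated_congruence G S)"
      unfolding refl_on_def mem using equiv by (meson equiv_def refl_onD)
    show "sym (generated_congruence G S)"
      unfolding sym_def mem using equiv by (meson equiv_def symD)
    show "trans (generated_congruence G S)"
      unfolding trans_def mem using equiv by (meson equiv_def transD)
  qed
  moreover have "(a \<otimes>\<^bsub>G\<^esub> c, b \<otimes>\<^bsub>G\<^esub> d) \<in> generated_congruence G S"
    if "(a, b) \<in> generated_congruence G S" "(c, d) \<in> generated_congruence G S" for a b c d
    using that unfolding mem by (meson monoid_congruence_mult)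
  ultimately show ?thesis
    by (auto simp: monoid_congruence_def)
qed

lemma monoid_congruence_kernel:
  assumes "monoid G" "h \<in> hom G H"
  shows "monoid_congruence G (kernel_congruence G h)"
proof -
  interpret monoid G by fact
  show ?thesis
    using assms(2)
    by (auto simp: monoid_congruence_def kernel_congruence_def equiv_def refl_on_def sym_def
        trans_def hom_def)
qed

text \<open>The relations whose images lie in the congruence form a congruence, so it is enough to
  look at the images of the generating relations.\<close>

lemma generated_congruence_map:
  assumes "monoid G" "monoid H" "h \<in> hom G H"
    and S: "S \<subseteq> carrier G \<times> carrier G" and T: "T \<subseteq> carrier H \<times> carrier H"
    and ST: "\<And>x y. (x, y) \<in> S \<Longrightarrow> (h x, h y) \<in> generated_congruence H T"
    and xy: "(x, y) \<in> generated_congruence G S"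
  shows "(h x, h y) \<in> generated_congruence H T"
proof -
  interpret monoid G by fact
  let ?P = "{(x, y). x \<in> carrier G \<and> y \<in> carrier G
    \<and> (h x, h y) \<in> generated_congruence H T}"
  have T_cong: "monoid_congruence H (generated_congruence H T)"
    using \<open>monoid H\<close> T by (rule monoid_congruence_generated)
  have T_equiv: "equiv (carrier H) (generated_congruence H T)"
    using T_cong by (simp add: monoid_congruence_def)
  have hc: "h x \<in> carrier H" if "x \<in> carrier G" for x
    using assms(3) that by (auto simp: hom_def)
  have "equiv (carrier G) ?P"
  proof (rule equivI)
    show "refl_on (carrier G) ?P"
      using T_equiv hc by (auto simp: equiv_def refl_on_def)
    show "sym ?P"
      using T_equiv by (auto simp: equiv_def intro!: symI dest: symD)
    show "trans ?P"
      using T_equiv by (auto simp: equiv_def intro!: transI dest: transD)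
  qed auto
  moreover have "(h (a \<otimes>\<^bsub>G\<^esub> c), h (b \<otimes>\<^bsub>G\<^esub> d)) \<in> generated_congruence H T"
    if "(a, b) \<in> ?P" "(c, d) \<in> ?P" for a b c d
    using monoid_congruence_mult[OF T_cong, of "h a" "h b" "h c" "h d"] that assms(3)
    by (auto simp: hom_def)
  ultimately have "monoid_congruence G ?P"
    by (auto simp: monoid_congruence_def)
  moreover have "S \<subseteq> ?P" using S ST by auto
  ultimately have "generated_congruence G S \<subseteq> ?P" by (rule generated_congruence_least)
  then show ?thesis using xy by auto
qed

section \<open>The relations hold in every AdMonB-algebra\<close>

context AdMonB
begin

lemma endo_closed: "x \<in> carrier A \<Longrightarrow> endo A x \<in> carrier A"
  using endo_hom by (auto simp: hom_def)

lemma endo_mult: "x \<in> carrier A \<Longrightarrow> y \<in> carrier A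
    \<Longrightarrow> endo A (x \<otimes> y) = endo A x \<otimes> endo A y"
  using endo_hom by (auto simp: hom_def)

lemma endo_pow_closed: "x \<in> carrier A \<Longrightarrow> (endo A ^^ k) x \<in> carrier A"
  by (induction k) (auto simp: endo_closed)

lemma endo_pow_mult: "x \<in> carrier A \<Longrightarrow> y \<in> carrier A
    \<Longrightarrow> (endo A ^^ k) (x \<otimes> y) = (endo A ^^ k) x \<otimes> (endo A ^^ k) y"
  by (induction k) (auto simp: endo_mult endo_pow_closed)

lemma endo_pow_one: "(endo A ^^ k) \<one> = \<one>"
  by (induction k) (auto simp: endo_one)

lemma eta_n_closed: "eta_n A k \<in> carrier A"
  by (simp add: eta_n_def endo_pow_closed eta_closed)

lemma eps_n_closed: "eps_n A k \<in> carrier A"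
  by (simp add: eps_n_def endo_pow_closed eps_closed)

lemma eta_n_add: "(endo A ^^ i) (eta_n A k) = eta_n A (i + k)"
  by (simp add: eta_n_def funpow_add)

lemma eps_n_add: "(endo A ^^ i) (eps_n A k) = eps_n A (i + k)"
  by (simp add: eps_n_def funpow_add)

text \<open>The axioms in \<open>m\<close>, shifted by \<open>f\<^sup>i\<close>; for \<open>m\<close> a generator they give every relation whose
  indices are far enough apart.\<close>

lemma eps_n_endo_pow:
  assumes "m \<in> carrier A"
  shows "eps_n A i \<otimes> (endo A ^^ (i + 2)) m = (endo A ^^ (i + 1)) m \<otimes> eps_n A i"
  using arg_cong[OF eps_endo_endo[OF assms], of "endo A ^^ i"] assms
  by (simp add: endo_pow_mult endo_closed eps_closed eps_n_def funpow_swap1)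

lemma endo_pow_eta_n:
  assumes "m \<in> carrier A"
  shows "(endo A ^^ (i + 1)) m \<otimes> eta_n A i = eta_n A i \<otimes> (endo A ^^ i) m"
  using arg_cong[OF endo_eta[OF assms], of "endo A ^^ i"] assms
  by (simp add: endo_pow_mult endo_closed eta_closed eta_n_def funpow_swap1)

lemma eps_n_eps_n:
  assumes "i < j"
  shows "eps_n A i \<otimes> eps_n A j = eps_n A (j - 1) \<otimes> eps_n A i"
proof (cases "j = i + 1")
  case True
  then show ?thesis
    using arg_cong[OF eps_endo_eps, of "endo A ^^ i"]
    by (simp add: endo_pow_mult endo_closed eps_closed eps_n_def funpow_swap1)
next
  case False
  define k where "k = j - i - 2"
  have j: "j = i + 2 + k" using assms False by (simp add: k_def)
  show ?thesis
    using eps_n_endo_pow[OF eps_n_closed, of i k] unfolding eps_n_add j by simp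
qed

lemma eta_n_eta_n:
  assumes "i < j"
  shows "eta_n A j \<otimes> eta_n A i = eta_n A i \<otimes> eta_n A (j - 1)"
proof -
  define k where "k = j - i - 1"
  have j: "j = i + 1 + k" using assms by (simp add: k_def)
  show ?thesis
    using endo_pow_eta_n[OF eta_n_closed, of i k] unfolding eta_n_add j by simp
qed

lemma eps_n_eta_n_above:
  assumes "i + 1 < j"
  shows "eps_n A i \<otimes> eta_n A j = eta_n A (j - 1) \<otimes> eps_n A i"
proof -
  define k where "k = j - i - 2"
  have j: "j = i + 2 + k" using assms by (simp add: k_def)
  show ?thesis
    using eps_n_endo_pow[OF eta_n_closed, of i k] unfolding eta_n_add j by simp
qed

lemma eps_n_eta_n_below:
  assumes "j < i"
  shows "eps_n A i \<otimes> eta_n A j = eta_n A j \<otimes> eps_n A (i - 1)"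
proof -
  define k where "k = i - j - 1"
  have i: "i = j + 1 + k" using assms by (simp add: k_def)
  show ?thesis
    using endo_pow_eta_n[OF eps_n_closed, of j k] unfolding eps_n_add i by simp
qed

lemma eps_n_eta_n_same: "eps_n A i \<otimes> eta_n A i = \<one>"
  using arg_cong[OF eps_eta, of "endo A ^^ i"]
  by (simp add: endo_pow_mult eps_closed eta_closed eps_n_def eta_n_def endo_pow_one)

lemma eps_n_eta_n_Suc: "eps_n A i \<otimes> eta_n A (Suc i) = \<one>"
  using arg_cong[OF eps_endo_eta, of "endo A ^^ i"]
  by (simp add: endo_pow_mult endo_closed eps_closed eta_closed eps_n_def eta_n_def
      endo_pow_one funpow_swap1)

end

lemma R0_subset_R: "R0 \<subseteq> R"
proof -
  interpret AdMonB F_empty by (rule AdMonB_F_empty)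
  have r1: "fmul x fone = x" for x using r_one[of x] by simp
  have canon_pair: "canon [x, y] = fmul (symb_val x) (symb_val y)" for x y
    by (simp add: r1)
  \<comment> \<open>For \<open>i = j > 0\<close> the right-hand side \<open>\<epsilon>\<^sub>i\<^sub>-\<^sub>1 \<eta>\<^sub>i\<close> is \<open>1\<close> as well.\<close>
  have diag: "fmul (eps_n F_empty (i - 1)) (eta_n F_empty i) = fone" if "0 < i" for i
    using eps_n_eta_n_Suc[of "i - 1"] that by simp
  have "canon u = canon v" if "(u, v) \<in> R0" for u v
    using that unfolding R0_def
    by (elim UnE CollectE exE conjE; clarsimp simp only: canon_pair symb_val.simps prod.inject)
      (use eps_n_eps_n eta_n_eta_n eps_n_eta_n_above eps_n_eta_n_below eps_n_eta_n_same
        eps_n_eta_n_Suc diag in \<open>simp_all only: canon.simps F_empty_simps Suc_eq_plus1\<close>)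
  then show ?thesis
    by (auto simp: R_def kernel_congruence_def F_Mon_def)
qed

section \<open>Words modulo the relations form an AdMonB-algebra\<close>

abbreviation R0_equiv :: "symb list \<Rightarrow> symb list \<Rightarrow> bool" (infix "\<approx>" 50) where
  "u \<approx> v \<equiv> (u, v) \<in> generated_congruence F_Mon R0"

lemma R0_equiv_congruence: "monoid_congruence F_Mon (generated_congruence F_Mon R0)"
  by (rule monoid_congruence_generated[OF F_Mon_monoid]) (simp add: F_Mon_def)

lemma R0_equiv_equiv: "equiv UNIV (generated_congruence F_Mon R0)"
  using R0_equiv_congruence by (simp add: monoid_congruence_def F_Mon_def)

lemma R0_equiv_refl: "u \<approx> u"
  using R0_equiv_equiv by (auto simp: equiv_def refl_on_def)

lemma R0_equiv_sym: "u \<approx> v \<Longrightarrow> v \<approx> u"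
  using R0_equiv_equiv by (auto simp: equiv_def dest: symD)

lemma R0_equiv_trans [trans]: "u \<approx> v \<Longrightarrow> v \<approx> w \<Longrightarrow> u \<approx> w"
  using R0_equiv_equiv by (auto simp: equiv_def dest: transD)

lemma R0_equiv_append: "u \<approx> u' \<Longrightarrow> v \<approx> v' \<Longrightarrow> u @ v \<approx> u' @ v'"
  using monoid_congruence_mult[OF R0_equiv_congruence] by (simp add: F_Mon_def)

lemma R0_equiv_base: "(u, v) \<in> R0 \<Longrightarrow> u \<approx> v"
  using generated_congruence_base by blast

text \<open>Descending from index \<open>i\<close> to index \<open>0\<close>, each step being
  \<open>\<epsilon>\<^sub>i \<eta>\<^sub>i = \<epsilon>\<^sub>i\<^sub>-\<^sub>1 \<eta>\<^sub>i = \<epsilon>\<^sub>i\<^sub>-\<^sub>1 \<eta>\<^sub>i\<^sub>-\<^sub>1\<close>.\<close>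

lemma R0_equiv_eps_eta: "[Eps i, Eta i] \<approx> []"
proof (induction i)
  case 0
  show ?case by (rule R0_equiv_base) (simp add: R0_def)
next
  case (Suc i)
  have "[Eps (Suc i), Eta (Suc i)] \<approx> [Eps i, Eta (Suc i)]"
    by (rule R0_equiv_base) (simp add: R0_def)
  also have "[Eps i, Eta (Suc i)] \<approx> [Eps i, Eta i]"
    by (rule R0_equiv_base) (simp add: R0_def)
  also note Suc.IH
  finally show ?case .
qed

primrec raise_symb :: "symb \<Rightarrow> symb" where
  "raise_symb (Eta k) = Eta (Suc k)"
| "raise_symb (Eps k) = Eps (Suc k)"

abbreviation raise :: "symb list \<Rightarrow> symb list" where
  "raise \<equiv> map raise_symb"

text \<open>Raising all indices by one preserves the shape of every relation except the one that is
  stated for a single index only.\<close>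

lemma R0_raise:
  assumes "(u, v) \<in> R0"
  shows "(raise u, raise v) \<in> R0 \<or> u = [Eps 0, Eta 0] \<and> v = []"
  using assms[unfolded R0_def]
  by (elim UnE CollectE exE conjE) (simp_all add: R0_def)

lemma R0_equiv_raise:
  assumes "u \<approx> v"
  shows "raise u \<approx> raise v"
proof (rule generated_congruence_map[OF F_Mon_monoid F_Mon_monoid _ _ _ _ assms])
  show "raise \<in> hom F_Mon F_Mon" by (auto simp: hom_def F_Mon_def)
  show "raise x \<approx> raise y" if "(x, y) \<in> R0" for x y
    using R0_raise[OF that] R0_equiv_eps_eta by (auto intro: R0_equiv_base)
qed (simp_all add: F_Mon_def)

lemma R0_equiv_eps_raise2: "[Eps 0] @ raise (raise u) \<approx> raise u @ [Eps 0]"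
proof (induction u)
  case Nil
  show ?case by (simp add: R0_equiv_refl)
next
  case (Cons x u)
  have "[Eps 0, raise_symb (raise_symb x)] \<approx> [raise_symb x, Eps 0]"
    by (rule R0_equiv_base) (cases x; simp add: R0_def)
  from R0_equiv_append[OF this R0_equiv_refl]
  have "[Eps 0] @ raise (raise (x # u)) \<approx> [raise_symb x] @ [Eps 0] @ raise (raise u)"
    by simp
  also have "[raise_symb x] @ [Eps 0] @ raise (raise u) \<approx> [raise_symb x] @ raise u @ [Eps 0]"
    by (rule R0_equiv_append[OF R0_equiv_refl Cons.IH])
  finally show ?case by simp
qed

lemma R0_equiv_raise_eta: "raise u @ [Eta 0] \<approx> [Eta 0] @ u"
proof (induction u)
  case Nil
  show ?case by (simp add: R0_equiv_refl)
next
  case (Cons x u)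
  have "raise (x # u) @ [Eta 0] \<approx> [raise_symb x] @ [Eta 0] @ u"
    using R0_equiv_append[OF R0_equiv_refl Cons.IH, of "[raise_symb x]"] by simp
  also have "[raise_symb x, Eta 0] \<approx> [Eta 0, x]"
    by (rule R0_equiv_base) (cases x; simp add: R0_def)
  from R0_equiv_append[OF this R0_equiv_refl]
  have "[raise_symb x] @ [Eta 0] @ u \<approx> [Eta 0] @ x # u" by simp
  finally show ?case .
qed

primrec word_of_term :: "adterm \<Rightarrow> symb list" where
  "word_of_term TOne = []"
| "word_of_term (TMul s t) = word_of_term s @ word_of_term t"
| "word_of_term (TEndo s) = raise (word_of_term s)"
| "word_of_term TEta = [Eta 0]"
| "word_of_term TEps = [Eps 0]"

text \<open>Each axiom of AdMonB holds for words modulo the relations, so this is soundness of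
  equational logic for that algebra.\<close>

lemma adeq_word_of_term: "adeq s t \<Longrightarrow> word_of_term s \<approx> word_of_term t"
proof (induction rule: adeq.induct)
  case (adeq_sym s t)
  show ?case using adeq_sym.IH by (rule R0_equiv_sym)
next
  case (adeq_trans s t u)
  show ?case using adeq_trans.IH by (rule R0_equiv_trans)
next
  case adeq_eps_eta
  show ?case using R0_equiv_eps_eta[of 0] by simp
next
  case adeq_eps_endo_eta
  have "[Eps 0, Eta 1] \<approx> [Eps 0, Eta 0]"
    by (rule R0_equiv_base) (simp add: R0_def)
  also note R0_equiv_eps_eta
  finally show ?case by simp
next
  case adeq_eps_endo_eps
  show ?case by (rule R0_equiv_base) (simp add: R0_def)
next
  case (adeq_eps_endo_endo s)
  show ?case using R0_equiv_eps_raise2[of "word_of_term s"] by simp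
next
  case (adeq_endo_eta s)
  show ?case using R0_equiv_raise_eta[of "word_of_term s"] by simp
qed (simp_all add: R0_equiv_refl R0_equiv_append R0_equiv_raise)

section \<open>Words as terms\<close>

primrec term_of_symb :: "symb \<Rightarrow> adterm" where
  "term_of_symb (Eta k) = (TEndo ^^ k) TEta"
| "term_of_symb (Eps k) = (TEndo ^^ k) TEps"

primrec term_of_word :: "symb list \<Rightarrow> adterm" where
  "term_of_word [] = TOne"
| "term_of_word (x # u) = TMul (term_of_symb x) (term_of_word u)"

lemma word_of_term_of_word: "word_of_term (term_of_word u) = u"
proof -
  have "word_of_term ((TEndo ^^ k) TEta) = [Eta k]"
    "word_of_term ((TEndo ^^ k) TEps) = [Eps k]" for k
    by (induction k) auto
  then have "word_of_term (term_of_symb x) = [x]" for x by (cases x) auto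
  then show ?thesis by (induction u) auto
qed

lemma canon_eq_abs_term: "canon u = abs_adfree (term_of_word u)"
proof -
  have "(fendo ^^ k) (abs_adfree t) = abs_adfree ((TEndo ^^ k) t)" for k t
    by (induction k) (auto simp: fendo.abs_eq)
  then have "symb_val x = abs_adfree (term_of_symb x)" for x
    by (cases x) (auto simp: eta_n_def eps_n_def feta_def feps_def)
  then show ?thesis by (induction u) (auto simp: fone_def fmul.abs_eq)
qed

lemma canon_eq_imp_R0_equiv:
  assumes "canon u = canon v"
  shows "u \<approx> v"
proof -
  have "adeq (term_of_word u) (term_of_word v)"
    using assms by (simp add: canon_eq_abs_term adfree.abs_eq_iff)
  then show ?thesis
    using adeq_word_of_term word_of_term_of_word by metis
qed

theorem proposition5: "R = generated_congruence F_Mon R0"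
proof
  have "monoid_congruence F_Mon R"
    unfolding R_def using F_Mon_monoid canon_hom(1) by (rule monoid_congruence_kernel)
  then show "generated_congruence F_Mon R0 \<subseteq> R"
    using R0_subset_R by (rule generated_congruence_least)
  show "R \<subseteq> generated_congruence F_Mon R0"
    using canon_eq_imp_R0_equiv by (auto simp: R_def kernel_congruence_def)
qed

end
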